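(* Any nonempty separable metrizable zero-dimensional space $X$ is a continuous open retract of a precompact Boolean group; that is, there exist a precompact Boolean topological group $G$, a topological embedding of $X$ into $G$, and a continuous retraction of $G$ onto (the image of) $X$ which is open as a map onto $X$.
   Context: A Boolean group is a group in which every element satisfies $g+g=0$. A topological group is precompact if for each neighbourhood $U$ of the identity finitely many translates of $U$ cover the group. *)

theory Defs
  imports "HOL-Analysis.Analysis" "HOL-Algebra.Coset"
begin

definition zero_dimensional_space :: "'a topology \<Rightarrow> bool" where
  "zero_dimensional_space X \<longleftrightarrow>
     neighbourhood_base_of (\<lambda>U. openin X U \<and> closedin X U) X"

text \<open>This is the same as small inductive dimension at most \<open>0\<close>.\<close>

lemma zero_dimensional_space_iff_dim_le_0: "zero_dimensional_space X \<longleftrightarrow> X dim_le 0"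
proof -
  have "subtopology X (X frontier_of U) dim_le -1 \<longleftrightarrow> X frontier_of U = {}" for U
  proof
    assume "subtopology X (X frontier_of U) dim_le -1"
    moreover have "\<not> Y dim_le (-2)" for Y :: "'a topology"
      by (auto elim: dimension_le.cases)
    ultimately have "topspace (subtopology X (X frontier_of U)) = {}"
      by (force elim: dimension_le.cases)
    then show "X frontier_of U = {}"
      by (simp add: frontier_of_subset_topspace inf.absorb2)
  next
    assume "X frontier_of U = {}"
    then show "subtopology X (X frontier_of U) dim_le -1"
      by (auto intro: dimension_le.intros)
  qed
  then have "X dim_le 0 \<longleftrightarrow>
      neighbourhood_base_of (\<lambda>U. openin X U \<and> X frontier_of U = {}) X"
    by (simp add: dimension_le_neighbourhood_base [of X 0])
  moreover have "(openin X U \<and> X frontier_of U = {}) \<longleftrightarrow> (openin X U \<and> closedin X U)" for U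
    using clopenin_eq_frontier_of [of X U] openin_subset [of X U] by auto
  ultimately show ?thesis
    by (simp add: zero_dimensional_space_def)
qed

text \<open>
  HOL-Algebra's \<open>group\<close> is written multiplicatively, so \<open>g + g = 0\<close> appears
  as \<open>g \<otimes> g = \<one>\<close>.
\<close>

definition boolean_group :: "('g, 'm) monoid_scheme \<Rightarrow> bool" where
  "boolean_group G \<longleftrightarrow> group G \<and> (\<forall>g \<in> carrier G. g \<otimes>\<^bsub>G\<^esub> g = \<one>\<^bsub>G\<^esub>)"

text \<open>No separation axiom is part of the following definition.\<close>

definition topological_group :: "('g, 'm) monoid_scheme \<Rightarrow> 'g topology \<Rightarrow> bool" where
  "topological_group G T \<longleftrightarrow>
     group G \<and> topspace T = carrier G \<and>
     continuous_map (prod_topology T T) T (\<lambda>(x, y). x \<otimes>\<^bsub>G\<^esub> y) \<and>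
     continuous_map T T (\<lambda>x. inv\<^bsub>G\<^esub> x)"

definition precompact_group :: "('g, 'm) monoid_scheme \<Rightarrow> 'g topology \<Rightarrow> bool" where
  "precompact_group G T \<longleftrightarrow>
     topological_group G T \<and>
     (\<forall>U. U \<subseteq> carrier G \<and> \<one>\<^bsub>G\<^esub> \<in> T interior_of U \<longrightarrow>
       (\<exists>F. finite F \<and> F \<subseteq> carrier G \<and> carrier G = (\<Union>g\<in>F. g <#\<^bsub>G\<^esub> U)))"

end

(* The group consists of the finite subsets of X under symmetric difference, with the coarsest
   topology for which the parity of F \<inter> D is a continuous function of F for every clopen set D.
   A finite set F and a clopen base C 0, C 1, ... determine a decreasing sequence of clopen sets
   A n, each cut by C n, where the next half is chosen by looking at the parities of F on the two
   halves and at a distinguished point p (A n). These sets shrink to a point \<rho> F, and F \<mapsto> {\<rho> F} is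
   the retraction. Once A n separates the points of F, replacing F by its symmetric difference
   with {\<rho> F, y} moves \<rho> F to any prescribed y in A n, which gives openness. *)
theory Submission
  imports Defs
begin

section \<open>Countable clopen bases\<close>

text \<open>The balls of radius 1/(n+1) around a countable dense set form a base: a center within
  1/(n+1) < r/2 of \<open>x\<close> gives a ball that contains \<open>x\<close> and stays within
  distance r of it.\<close>

lemma separable_metrizable_imp_second_countable:
  assumes "separable_space X" and "metrizable_space X"
  shows "second_countable X"
proof -
  obtain M d where M: "Metric_space M d" and X: "X = Metric_space.mtopology M d"
    using assms(2) unfolding metrizable_space_def by blast
  interpret Metric_space M d by (rule M)
  obtain S where S: "countable S" "S \<subseteq> M" "mtopology closure_of S = M"
    using assms(1) unfolding separable_space_def X by auto
  let ?B = "(\<lambda>(s, n). mball s (1 / real (Suc n))) ` (S \<times> UNIV)"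
  show ?thesis
    unfolding second_countable_def
  proof (intro exI[of _ ?B] conjI allI impI ballI)
    show "countable ?B"
      using S(1) by auto
    show "openin X V" if "V \<in> ?B" for V
      using that unfolding X by auto
    fix U x
    assume Ux: "openin X U \<and> x \<in> U"
    then obtain r where r: "r > 0" "mball x r \<subseteq> U" and xM: "x \<in> M"
      unfolding X openin_mtopology by blast
    obtain n where n: "1 / real (Suc n) < r / 2"
      using nat_approx_posE[of "r / 2"] r(1) by auto
    have "x \<in> mtopology closure_of S"
      using S(3) xM by simp
    then have "\<forall>e>0. \<exists>s\<in>S. s \<in> mball x e"
      unfolding metric_closure_of by simp
    moreover have "1 / real (Suc n) > 0"
      by simp
    ultimately obtain s where s: "s \<in> S" "s \<in> mball x (1 / real (Suc n))"
      by blast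
    have "x \<in> mball s (1 / real (Suc n))"
      using s(2) by (auto simp: commute)
    moreover have "mball s (1 / real (Suc n)) \<subseteq> mball x r"
    proof
      fix z
      assume z: "z \<in> mball s (1 / real (Suc n))"
      then have "d x z \<le> d x s + d s z"
        using s(2) by (auto intro: triangle)
      moreover have "d x s < 1 / real (Suc n)" "d s z < 1 / real (Suc n)" "z \<in> M"
        using z s(2) by (simp_all only: in_mball)
      ultimately show "z \<in> mball x r"
        using n xM unfolding in_mball by linarith
    qed
    moreover have "mball s (1 / real (Suc n)) \<in> ?B"
      using s(1) by (intro image_eqI[of _ _ "(s, n)"]) auto
    ultimately show "\<exists>V\<in>?B. x \<in> V \<and> V \<subseteq> U"
      using r(2) by (meson subset_trans)
  qed
qed

lemma zero_dimensional_iff_clopen: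
  "zero_dimensional_space X \<longleftrightarrow>
     (\<forall>W x. openin X W \<and> x \<in> W \<longrightarrow> (\<exists>U. openin X U \<and> closedin X U \<and> x \<in> U \<and> U \<subseteq> W))"
  unfolding zero_dimensional_space_def
  by (subst open_neighbourhood_base_of) auto

text \<open>A countable base need not consist of clopen sets, and the base of all clopen sets need
  not be countable. One clopen set is therefore chosen between \<open>U\<close> and \<open>V\<close>
  for each pair of basic sets that admits one, and there are only countably many pairs.\<close>

lemma countable_clopen_base:
  assumes "second_countable X" and "zero_dimensional_space X"
  shows "\<exists>C :: nat \<Rightarrow> 'a set. (\<forall>n. openin X (C n) \<and> closedin X (C n)) \<and>
    (\<forall>W x. openin X W \<and> x \<in> W \<longrightarrow> (\<exists>n. x \<in> C n \<and> C n \<subseteq> W))"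
proof -
  obtain B where B: "countable B" "\<And>V. V \<in> B \<Longrightarrow> openin X V"
    "\<And>U x. openin X U \<Longrightarrow> x \<in> U \<Longrightarrow> \<exists>V\<in>B. x \<in> V \<and> V \<subseteq> U"
    using assms(1) unfolding second_countable_def by metis
  define K where "K U V D \<longleftrightarrow> openin X D \<and> closedin X D \<and> U \<subseteq> D \<and> D \<subseteq> V" for U V D
  define I where "I = {(U, V) \<in> B \<times> B. \<exists>D. K U V D}"
  define f where "f = (\<lambda>(U, V). SOME D. K U V D)"
  have f: "K U V (f (U, V))" if "(U, V) \<in> I" for U V
    using that someI_ex[of "K U V"] unfolding f_def I_def by auto
  \<comment> \<open>The empty set is clopen and harmless in a base; with it the family is nonempty
    and can be enumerated by \<open>from_nat_into\<close> even when \<open>I\<close> is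
    empty.\<close>
  define \<C> where "\<C> = insert {} (f ` I)"
  have "countable I"
    unfolding I_def by (rule countable_subset[of _ "B \<times> B"]) (use B(1) in auto)
  then have "countable \<C>" "\<C> \<noteq> {}"
    unfolding \<C>_def by auto
  then have range: "range (from_nat_into \<C>) = \<C>"
    by (simp add: range_from_nat_into)
  have clopen: "openin X D \<and> closedin X D" if "D \<in> \<C>" for D
    using that f unfolding \<C>_def K_def by auto
  have base: "\<exists>D\<in>\<C>. x \<in> D \<and> D \<subseteq> W" if W: "openin X W" "x \<in> W" for W x
  proof -
    obtain V where V: "V \<in> B" "x \<in> V" "V \<subseteq> W"
      using B(3) W by blast
    obtain D where D: "openin X D" "closedin X D" "x \<in> D" "D \<subseteq> V"
      using assms(2) B(2) V unfolding zero_dimensional_iff_clopen by metis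
    obtain U where U: "U \<in> B" "x \<in> U" "U \<subseteq> D"
      using B(3) D by blast
    \<comment> \<open>\<open>D\<close> only witnesses that the pair is admissible. The chosen set
      \<open>f (U, V)\<close> may differ from \<open>D\<close>, but it also lies between
      \<open>U\<close> and \<open>V\<close>.\<close>
    have "(U, V) \<in> I"
      using U V D unfolding I_def K_def by auto
    then show ?thesis
      using f[of U V] U(2) V(3) unfolding \<C>_def K_def by blast
  qed
  show ?thesis
  proof (intro exI[of _ "from_nat_into \<C>"] conjI)
    show "\<forall>n. openin X (from_nat_into \<C> n) \<and> closedin X (from_nat_into \<C> n)"
      using clopen range by blast
    show "\<forall>W x. openin X W \<and> x \<in> W \<longrightarrow>
        (\<exists>n. x \<in> from_nat_into \<C> n \<and> from_nat_into \<C> n \<subseteq> W)"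
      using base range by (metis imageE)
  qed
qed

section \<open>The group of finite subsets and its parity topology\<close>

text \<open>This is the free Boolean group on \<open>S\<close>, the vector space over the field of
  two elements with the singletons as basis.\<close>

definition finite_subset_group :: "'a set \<Rightarrow> 'a set monoid" where
  "finite_subset_group S =
     \<lparr>carrier = {F. finite F \<and> F \<subseteq> S}, monoid.mult = (\<lambda>F E. sym_diff F E), one = {}\<rparr>"

lemma finite_subset_group_simps [simp]:
  "F \<in> carrier (finite_subset_group S) \<longleftrightarrow> finite F \<and> F \<subseteq> S"
  "F \<otimes>\<^bsub>finite_subset_group S\<^esub> E = sym_diff F E"
  "\<one>\<^bsub>finite_subset_group S\<^esub> = {}"
  by (auto simp: finite_subset_group_def)

lemma group_finite_subset_group: "group (finite_subset_group S)"
  by (rule groupI) auto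

lemma boolean_group_finite_subset_group: "boolean_group (finite_subset_group S)"
  by (simp add: boolean_group_def group_finite_subset_group)

lemma inv_finite_subset_group:
  "F \<in> carrier (finite_subset_group S) \<Longrightarrow> inv\<^bsub>finite_subset_group S\<^esub> F = F"
  by (rule group.inv_equality[OF group_finite_subset_group]) auto

text \<open>On finite sets this is the homomorphism to the group of order two that extends the
  indicator function of \<open>D\<close>.\<close>

definition odd_on :: "'a set \<Rightarrow> 'a set \<Rightarrow> bool" where
  "odd_on D F \<longleftrightarrow> odd (card (F \<inter> D))"

lemma odd_on_empty [simp]: "\<not> odd_on D {}"
  by (simp add: odd_on_def)

lemma odd_on_singleton [simp]: "odd_on D {x} \<longleftrightarrow> x \<in> D"
  by (simp add: odd_on_def Int_insert_left)

text \<open>The points of \<open>D\<close> common to \<open>F\<close> and \<open>E\<close> are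
  counted once in each cardinality, hence twice in the sum, and do not affect its parity.\<close>

lemma odd_on_sym_diff:
  assumes "finite F" "finite E"
  shows "odd_on D (sym_diff F E) \<longleftrightarrow> odd_on D F \<noteq> odd_on D E"
proof -
  let ?f = "F \<inter> D" and ?e = "E \<inter> D"
  have "sym_diff F E \<inter> D = (?f - ?e) \<union> (?e - ?f)"
    by auto
  then have "card (sym_diff F E \<inter> D) = card (?f - ?e) + card (?e - ?f)"
    using assms by (simp only:) (rule card_Un_disjoint; auto)
  moreover have "card ?f = card (?f - ?e) + card (?f \<inter> ?e)"
    using assms card_Int_Diff[of ?f ?e] by simp
  moreover have "card ?e = card (?e - ?f) + card (?f \<inter> ?e)"
    using assms card_Int_Diff[of ?e ?f] by (simp add: Int_commute)
  ultimately show ?thesis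
    unfolding odd_on_def by auto
qed

definition clopens :: "'a topology \<Rightarrow> 'a set set" where
  "clopens X = {D. openin X D \<and> closedin X D}"

text \<open>For \<open>F\<close> in the group this is the coset through \<open>F\<close> of the
  common kernel of the parities on the members of \<D>.\<close>

definition parity_nbhd :: "'a topology \<Rightarrow> 'a set set \<Rightarrow> 'a set \<Rightarrow> 'a set set" where
  "parity_nbhd X \<D> F =
     {E \<in> carrier (finite_subset_group (topspace X)). \<forall>D\<in>\<D>. odd_on D E = odd_on D F}"

definition parity_topology :: "'a topology \<Rightarrow> 'a set topology" where
  "parity_topology X = topology (\<lambda>U. U \<subseteq> carrier (finite_subset_group (topspace X)) \<and>
     (\<forall>F\<in>U. \<exists>\<D>. finite \<D> \<and> \<D> \<subseteq> clopens X \<and> parity_nbhd X \<D> F \<subseteq> U))"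

lemma openin_parity_topology:
  "openin (parity_topology X) U \<longleftrightarrow> U \<subseteq> carrier (finite_subset_group (topspace X)) \<and>
     (\<forall>F\<in>U. \<exists>\<D>. finite \<D> \<and> \<D> \<subseteq> clopens X \<and> parity_nbhd X \<D> F \<subseteq> U)"
proof -
  let ?P = "\<lambda>U. U \<subseteq> carrier (finite_subset_group (topspace X)) \<and>
     (\<forall>F\<in>U. \<exists>\<D>. finite \<D> \<and> \<D> \<subseteq> clopens X \<and> parity_nbhd X \<D> F \<subseteq> U)"
  have Int: "?P (U \<inter> V)" if U: "?P U" and V: "?P V" for U V
  proof -
    have "\<exists>\<D>. finite \<D> \<and> \<D> \<subseteq> clopens X \<and> parity_nbhd X \<D> F \<subseteq> U \<inter> V"
      if F: "F \<in> U \<inter> V" for F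
    proof -
      obtain \<D> \<E> where "finite \<D>" "\<D> \<subseteq> clopens X" "parity_nbhd X \<D> F \<subseteq> U"
        "finite \<E>" "\<E> \<subseteq> clopens X" "parity_nbhd X \<E> F \<subseteq> V"
        using U V F by blast
      \<comment> \<open>Imposing more parities shrinks the neighbourhood, so the union of the two
        finite families serves the intersection.\<close>
      moreover have "parity_nbhd X (\<D> \<union> \<E>) F \<subseteq> parity_nbhd X \<D> F \<inter> parity_nbhd X \<E> F"
        unfolding parity_nbhd_def by auto
      ultimately show ?thesis
        by (intro exI[of _ "\<D> \<union> \<E>"]) auto
    qed
    then show ?thesis
      using U by blast
  qed
  have Union: "?P (\<Union>\<K>)" if K: "\<forall>U\<in>\<K>. ?P U" for \<K>
  proof -
    have "\<Union>\<K> \<subseteq> carrier (finite_subset_group (topspace X))"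
      using K by blast
    moreover have "\<forall>F\<in>\<Union>\<K>. \<exists>\<D>. finite \<D> \<and> \<D> \<subseteq> clopens X \<and> parity_nbhd X \<D> F \<subseteq> \<Union>\<K>"
      using K by (meson UnionE Union_upper subset_trans)
    ultimately show ?thesis
      by blast
  qed
  have "istopology ?P"
    unfolding istopology_def
    by (rule conjI; intro allI impI; (rule Int | rule Union); assumption)
  then show ?thesis
    unfolding parity_topology_def by (simp add: topology_inverse')
qed

lemma topspace_parity_topology [simp]:
  "topspace (parity_topology X) = carrier (finite_subset_group (topspace X))"
proof -
  have "openin (parity_topology X) (carrier (finite_subset_group (topspace X)))"
    unfolding openin_parity_topology parity_nbhd_def by (auto intro!: exI[of _ "{}"])
  then show ?thesis
    by (meson openin_parity_topology openin_subset openin_topspace subset_antisym)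
qed

lemma openin_parity_nbhd:
  assumes "finite \<D>" "\<D> \<subseteq> clopens X"
  shows "openin (parity_topology X) (parity_nbhd X \<D> F)"
  unfolding openin_parity_topology
  using assms by (auto simp: parity_nbhd_def intro!: exI[of _ \<D>])

lemma parity_nbhd_self:
  "F \<in> carrier (finite_subset_group (topspace X)) \<Longrightarrow> F \<in> parity_nbhd X \<D> F"
  by (simp add: parity_nbhd_def)

lemma topological_group_parity_topology:
  "topological_group (finite_subset_group (topspace X)) (parity_topology X)"
proof -
  let ?G = "finite_subset_group (topspace X)" and ?T = "parity_topology X"
  have "continuous_map (prod_topology ?T ?T) ?T (\<lambda>(x, y). sym_diff x y)"
    unfolding continuous_map_def
  proof (intro conjI allI impI)
    show "(\<lambda>(x, y). sym_diff x y) \<in> topspace (prod_topology ?T ?T) \<rightarrow> topspace ?T"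
      by auto
    fix U
    assume U: "openin ?T U"
    let ?W = "{z \<in> topspace (prod_topology ?T ?T). (case z of (x, y) \<Rightarrow> sym_diff x y) \<in> U}"
    show "openin (prod_topology ?T ?T) ?W"
      unfolding openin_prod_topology_alt
    proof (intro allI impI)
      fix F E
      assume FE: "(F, E) \<in> ?W"
      then obtain \<D> where D: "finite \<D>" "\<D> \<subseteq> clopens X" "parity_nbhd X \<D> (sym_diff F E) \<subseteq> U"
        using U unfolding openin_parity_topology by auto
      have "sym_diff F' E' \<in> parity_nbhd X \<D> (sym_diff F E)"
        if "F' \<in> parity_nbhd X \<D> F" "E' \<in> parity_nbhd X \<D> E" for F' E'
        using that FE by (auto simp: parity_nbhd_def odd_on_sym_diff)
      then have "parity_nbhd X \<D> F \<times> parity_nbhd X \<D> E \<subseteq> ?W"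
        using D(3) by (auto simp: parity_nbhd_def)
      moreover have "F \<in> parity_nbhd X \<D> F" "E \<in> parity_nbhd X \<D> E"
        using FE by (auto simp: parity_nbhd_def)
      ultimately show "\<exists>U V. openin ?T U \<and> openin ?T V \<and> F \<in> U \<and> E \<in> V \<and> U \<times> V \<subseteq> ?W"
        using openin_parity_nbhd[OF D(1,2)] by blast
    qed
  qed
  moreover have "continuous_map ?T ?T (\<lambda>x. inv\<^bsub>?G\<^esub> x)"
    by (rule continuous_map_eq[OF continuous_map_id]) (simp add: inv_finite_subset_group)
  ultimately show ?thesis
    by (simp add: topological_group_def group_finite_subset_group)
qed

text \<open>A neighbourhood of the identity contains the common kernel of finitely many parities.
  This kernel has finite index, since a coset is determined by its pattern of parities.\<close>

lemma precompact_group_parity_topology: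
  "precompact_group (finite_subset_group (topspace X)) (parity_topology X)"
  unfolding precompact_group_def
proof (intro conjI topological_group_parity_topology allI impI)
  let ?G = "finite_subset_group (topspace X)" and ?T = "parity_topology X"
  fix U
  assume U: "U \<subseteq> carrier ?G \<and> \<one>\<^bsub>?G\<^esub> \<in> ?T interior_of U"
  then obtain \<D> where D: "finite \<D>" "parity_nbhd X \<D> {} \<subseteq> U"
    unfolding interior_of_def openin_parity_topology by fastforce
  define \<pi> where "\<pi> F = {D \<in> \<D>. odd_on D F}" for F :: "'a set"
  have "\<pi> ` carrier ?G \<subseteq> Pow \<D>"
    unfolding \<pi>_def by auto
  then have "finite (\<pi> ` carrier ?G)"
    using D(1) finite_subset by auto
  \<comment> \<open>\<open>R\<close> realizes every parity pattern that occurs in the group, so it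
    meets every coset of the kernel.\<close>
  then obtain R where R: "R \<subseteq> carrier ?G" "finite R" "\<pi> ` carrier ?G = \<pi> ` R"
    using finite_subset_image[of "\<pi> ` carrier ?G" \<pi> "carrier ?G"] by blast
  have "F \<in> (\<Union>g\<in>R. g <#\<^bsub>?G\<^esub> U)" if F: "F \<in> carrier ?G" for F
  proof -
    obtain g where g: "g \<in> R" "\<pi> F = \<pi> g"
      using R(3) F by blast
    have fin: "finite F" "finite g" "F \<subseteq> topspace X" "g \<subseteq> topspace X"
      using F g(1) R(1) by (auto simp: subset_iff)
    have "odd_on D F = odd_on D g" if "D \<in> \<D>" for D
      using g(2) that unfolding \<pi>_def by blast
    then have "sym_diff g F \<in> parity_nbhd X \<D> {}"
      using fin by (auto simp: parity_nbhd_def odd_on_sym_diff)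
    then have "sym_diff g F \<in> U"
      using D(2) by blast
    moreover have "F = sym_diff g (sym_diff g F)"
      by auto
    ultimately show ?thesis
      using g(1) by (auto simp: l_coset_def)
  qed
  moreover have "(\<Union>g\<in>R. g <#\<^bsub>?G\<^esub> U) \<subseteq> carrier ?G"
    using U R(1) by (fastforce simp: l_coset_def)
  ultimately show "\<exists>F. finite F \<and> F \<subseteq> carrier ?G \<and> carrier ?G = (\<Union>g\<in>F. g <#\<^bsub>?G\<^esub> U)"
    using R(1,2) by blast
qed

section \<open>Separation in the parity topology and the embedding by singletons\<close>

lemma clopen_isolating_point:
  assumes "Hausdorff_space X" "zero_dimensional_space X" "finite F" "x \<in> topspace X"
  obtains D where "D \<in> clopens X" "x \<in> D" "F \<inter> D \<subseteq> {x}"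
proof -
  have "closedin X ((F - {x}) \<inter> topspace X)"
    using assms by (intro closedin_Hausdorff_finite) auto
  then have "openin X (topspace X - (F - {x}) \<inter> topspace X)"
    by blast
  then obtain D where "openin X D" "closedin X D" "x \<in> D" "D \<subseteq> topspace X - (F - {x}) \<inter> topspace X"
    using assms(2,4) unfolding zero_dimensional_iff_clopen by blast
  then show thesis
    by (intro that[of D]) (auto simp: clopens_def)
qed

lemma Hausdorff_parity_topology:
  assumes "Hausdorff_space X" "zero_dimensional_space X"
  shows "Hausdorff_space (parity_topology X)"
  unfolding Hausdorff_space_def
proof (intro allI impI)
  let ?T = "parity_topology X"
  fix F E
  assume "F \<in> topspace ?T \<and> E \<in> topspace ?T \<and> F \<noteq> E"
  then have FE: "finite F" "finite E" "F \<subseteq> topspace X" "E \<subseteq> topspace X" "F \<noteq> E"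
    by auto
  then obtain x where x: "x \<in> sym_diff F E"
    by blast
  \<comment> \<open>A clopen set that meets the symmetric difference in one point has different
    parities on \<open>F\<close> and \<open>E\<close>.\<close>
  obtain D where D: "D \<in> clopens X" "x \<in> D" "sym_diff F E \<inter> D \<subseteq> {x}"
    using clopen_isolating_point[OF assms, of "sym_diff F E" x] x FE by auto
  have "sym_diff F E \<inter> D = {x}"
    using x D by auto
  then have "odd_on D (sym_diff F E)"
    unfolding odd_on_def by simp
  then have "odd_on D F \<noteq> odd_on D E"
    using FE by (simp add: odd_on_sym_diff)
  then have "disjnt (parity_nbhd X {D} F) (parity_nbhd X {D} E)"
    by (auto simp: disjnt_def parity_nbhd_def)
  moreover have "F \<in> parity_nbhd X {D} F" "E \<in> parity_nbhd X {D} E"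
    using FE by (auto simp: parity_nbhd_def)
  ultimately show "\<exists>U V. openin ?T U \<and> openin ?T V \<and> F \<in> U \<and> E \<in> V \<and> disjnt U V"
    using openin_parity_nbhd[of "{D}" X] D(1) by blast
qed

text \<open>The case of empty \<open>F\<close> gives continuity of the embedding; general
  \<open>F\<close> serves for the openness of the retraction.\<close>

lemma continuous_map_translated_singleton:
  assumes "finite F" "F \<subseteq> topspace X"
  shows "continuous_map X (parity_topology X) (\<lambda>y. sym_diff F {y})"
  unfolding continuous_map_def
proof (intro conjI allI impI)
  show "(\<lambda>y. sym_diff F {y}) \<in> topspace X \<rightarrow> topspace (parity_topology X)"
    using assms by auto
  fix U
  assume U: "openin (parity_topology X) U"
  show "openin X {y \<in> topspace X. sym_diff F {y} \<in> U}"
  proof (subst openin_subopen, intro ballI)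
    fix y
    assume y: "y \<in> {y \<in> topspace X. sym_diff F {y} \<in> U}"
    then obtain \<D> where D: "finite \<D>" "\<D> \<subseteq> clopens X" "parity_nbhd X \<D> (sym_diff F {y}) \<subseteq> U"
      using U unfolding openin_parity_topology by auto
    \<comment> \<open>\<open>V\<close> consists of the points on the same side as \<open>y\<close>
      of every member of \<D>; exchanging \<open>y\<close> for such a point changes none of the
      prescribed parities.\<close>
    define V where "V = topspace X \<inter> (\<Inter>D\<in>\<D>. if y \<in> D then D else topspace X - D)"
    have "openin X V"
      unfolding V_def using D(1,2)
      by (cases "\<D> = {}") (auto intro!: openin_Int openin_Inter simp: clopens_def)
    moreover have "y \<in> V"
      using y unfolding V_def by auto
    moreover have "sym_diff F {z} \<in> U" if z: "z \<in> V" for z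
    proof -
      have "z \<in> D \<longleftrightarrow> y \<in> D" if "D \<in> \<D>" for D
        using z that unfolding V_def by (auto split: if_splits)
      moreover have "z \<in> topspace X"
        using z unfolding V_def by blast
      ultimately have "sym_diff F {z} \<in> parity_nbhd X \<D> (sym_diff F {y})"
        using assms unfolding parity_nbhd_def
        by (auto simp only: odd_on_sym_diff finite.intros odd_on_singleton
            finite_subset_group_simps mem_Collect_eq)
      then show ?thesis
        using D(3) by blast
    qed
    ultimately show "\<exists>T. openin X T \<and> y \<in> T \<and> T \<subseteq> {y \<in> topspace X. sym_diff F {y} \<in> U}"
      using openin_subset by blast
  qed
qed

lemma embedding_map_singleton:
  assumes "zero_dimensional_space X"
  shows "embedding_map X (parity_topology X) (\<lambda>x. {x})"
proof -
  let ?T = "parity_topology X" and ?e = "\<lambda>x. {x} :: 'a set"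
  have cont: "continuous_map X ?T ?e"
    using continuous_map_translated_singleton[of "{}" X] by simp
  have "open_map X (subtopology ?T (?e ` topspace X)) ?e"
    unfolding open_map_def
  proof (intro allI impI)
    fix U
    assume U: "openin X U"
    show "openin (subtopology ?T (?e ` topspace X)) (?e ` U)"
    proof (subst openin_subopen, intro ballI)
      fix F
      assume "F \<in> ?e ` U"
      then obtain x where x: "x \<in> U" "F = {x}"
        by blast
      obtain D where D: "openin X D" "closedin X D" "x \<in> D" "D \<subseteq> U"
        using assms U x(1) unfolding zero_dimensional_iff_clopen by metis
      \<comment> \<open>A singleton has odd parity on \<open>D\<close> exactly when its point lies
        in \<open>D\<close>, so \<open>?N\<close> is the image of \<open>D\<close>.\<close>
      let ?N = "parity_nbhd X {D} {x} \<inter> ?e ` topspace X"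
      have "openin (subtopology ?T (?e ` topspace X)) ?N"
        using openin_parity_nbhd[of "{D}" X] D by (auto simp: openin_subtopology clopens_def)
      moreover have "F \<in> ?N"
        using x openin_subset[OF U] by (auto simp: parity_nbhd_def)
      moreover have "?N \<subseteq> ?e ` U"
        using D by (auto simp: parity_nbhd_def)
      ultimately show "\<exists>T. openin (subtopology ?T (?e ` topspace X)) T \<and> F \<in> T \<and> T \<subseteq> ?e ` U"
        by blast
    qed
  qed
  then have "homeomorphic_map X (subtopology ?T (?e ` topspace X)) ?e"
    using cont continuous_map_image_subset_topspace[OF cont]
    by (intro bijective_open_imp_homeomorphic_map)
      (auto simp: continuous_map_in_subtopology topspace_subtopology_subset)
  then show ?thesis
    unfolding embedding_map_def .
qed

section \<open>The retraction\<close>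

text \<open>By \<open>p_subset\<close> the distinguished point of a shrinking set stays the same for
  as long as it remains in the set.\<close>

locale pointed_clopen_splitting =
  fixes X :: "'a topology" and C :: "nat \<Rightarrow> 'a set" and p :: "'a set \<Rightarrow> 'a"
  assumes Hausdorff: "Hausdorff_space X"
    and nonempty: "topspace X \<noteq> {}"
    and C_clopen: "C n \<in> clopens X"
    and C_base: "openin X W \<Longrightarrow> x \<in> W \<Longrightarrow> \<exists>n. x \<in> C n \<and> C n \<subseteq> W"
    and p_in: "openin X A \<Longrightarrow> A \<noteq> {} \<Longrightarrow> p A \<in> A"
    and p_subset: "B \<subseteq> A \<Longrightarrow> p A \<in> B \<Longrightarrow> p B = p A"
begin

(* If F is odd on A, the odd half is kept. If F is even on A, the half kept is the one containing
   p A when F is even on both halves, and the other one when F is odd on both. *)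
primrec path :: "'a set \<Rightarrow> nat \<Rightarrow> 'a set" where
  "path F 0 = topspace X"
| "path F (Suc n) =
     (if odd_on (path F n \<inter> C n) F \<noteq> (\<not> odd_on (path F n) F \<and> p (path F n) \<in> C n)
      then path F n \<inter> C n else path F n - C n)"

lemma path_clopen: "path F n \<in> clopens X"
proof (induction n)
  case (Suc n)
  then show ?case
    using C_clopen[of n] by (auto simp: clopens_def openin_diff closedin_diff)
qed (simp add: clopens_def)

lemma path_openin: "openin X (path F n)"
  using path_clopen by (simp add: clopens_def)

lemma path_antimono: "m \<le> n \<Longrightarrow> path F n \<subseteq> path F m"
  by (rule lift_Suc_antimono_le) auto

text \<open>Stage n+1 lies on one side of \<open>C n\<close>, and later stages only shrink. As the
  sets \<open>C n\<close> form a base, no two points can stay in the path forever.\<close>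

lemma path_cut: "n < m \<Longrightarrow> path F m \<subseteq> C n \<or> path F m \<inter> C n = {}"
  using path_antimono[of "Suc n" m F] by (auto split: if_splits)

lemma odd_on_imp_nonempty: "odd_on D F \<Longrightarrow> D \<noteq> {}"
  by (auto simp: odd_on_def)

text \<open>Each of the finitely many pairs of distinct points of \<open>F\<close> is separated by
  some \<open>C k\<close>; a stage \<open>m\<close> beyond all these indices keeps at most one point
  of each pair.\<close>

lemma path_separates:
  assumes "finite F" "F \<subseteq> topspace X"
  obtains m where "\<And>x y. x \<in> F \<inter> path F m \<Longrightarrow> y \<in> F \<inter> path F m \<Longrightarrow> x = y"
proof -
  have "\<exists>n. x \<in> C n \<and> y \<notin> C n" if "x \<in> F" "y \<in> F" "x \<noteq> y" for x y
  proof -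
    have "openin X (topspace X - {y})"
      using that assms(2) Hausdorff by (intro openin_diff closedin_Hausdorff_singleton) auto
    then show ?thesis
      using C_base[of "topspace X - {y}" x] that assms(2) by blast
  qed
  then obtain k where k: "\<And>x y. x \<in> F \<Longrightarrow> y \<in> F \<Longrightarrow> x \<noteq> y \<Longrightarrow> x \<in> C (k x y) \<and> y \<notin> C (k x y)"
    by metis
  let ?K = "(\<lambda>(x, y). k x y) ` (F \<times> F)"
  obtain m where m: "\<And>n. n \<in> ?K \<Longrightarrow> n < m"
    using finite_nat_set_iff_bounded[of ?K] assms(1) by (metis finite_SigmaI finite_imageI)
  show thesis
  proof (rule that[of m], rule ccontr)
    fix x y
    assume xy: "x \<in> F \<inter> path F m" "y \<in> F \<inter> path F m" "x \<noteq> y"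
    then have "k x y < m"
      using m by blast
    from path_cut[OF this, of F] show False
      using k[of x y] xy by blast
  qed
qed

(* With y = p A, the second alternative says that F does not meet A. *)
definition leads_to :: "'a set \<Rightarrow> nat \<Rightarrow> 'a \<Rightarrow> bool" where
  "leads_to F n y \<longleftrightarrow> y \<in> path F n \<and>
     (F \<inter> path F n = {y} \<or> F \<inter> path F n = sym_diff {y} {p (path F n)})"

text \<open>If \<open>F\<close> meets \<open>A\<close> only in \<open>y\<close>, the half kept is
  the odd one, which contains \<open>y\<close>. Otherwise \<open>F\<close> is even on
  \<open>A\<close>: when \<open>y\<close> and \<open>p A\<close> are on the same side, both halves
  are even and the half of \<open>p A\<close> is kept; when they are on different sides, both are
  odd and the half without \<open>p A\<close> is kept. In every case \<open>y\<close>
  survives.\<close>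

lemma leads_to_Suc:
  assumes "leads_to F n y"
  shows "leads_to F (Suc n) y"
proof -
  define A where "A = path F n"
  have A: "openin X A" "y \<in> A" "A \<noteq> {}"
    using assms path_openin unfolding leads_to_def A_def by auto
  have pA: "p A \<in> A"
    using p_in A by blast
  have ps: "p A \<in> C n \<Longrightarrow> p (A \<inter> C n) = p A" "p A \<notin> C n \<Longrightarrow> p (A - C n) = p A"
    using p_subset pA by auto
  have step: "path F (Suc n) = (if odd_on (A \<inter> C n) F \<noteq> (\<not> odd_on A F \<and> p A \<in> C n)
      then A \<inter> C n else A - C n)"
    unfolding A_def by simp
  have odd: "odd_on D F \<longleftrightarrow> odd_on D (F \<inter> A)" if "D \<subseteq> A" for D
    using that unfolding odd_on_def by (simp add: Int_absorb1 Int_assoc)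
  consider "F \<inter> A = {y}" | "F \<inter> A = sym_diff {y} {p A}"
    using assms unfolding leads_to_def A_def by blast
  then show ?thesis
  proof cases
    case 1
    then have "path F (Suc n) = (if y \<in> C n then A \<inter> C n else A - C n)"
      unfolding step using A(2) by (simp add: odd)
    then show ?thesis
      unfolding leads_to_def using 1 A(2) by auto
  next
    case 2
    then have "odd_on (A \<inter> C n) F \<longleftrightarrow> (y \<in> C n) \<noteq> (p A \<in> C n)" "\<not> odd_on A F"
      using A(2) pA by (simp_all only: odd Int_lower1 order_refl odd_on_sym_diff finite.intros
          odd_on_singleton Int_iff simp_thms)
    then have eq: "path F (Suc n) = (if y \<in> C n then A \<inter> C n else A - C n)"
      unfolding step by auto
    show ?thesis
    proof (cases "y \<in> C n \<longleftrightarrow> p A \<in> C n")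
      case True
      \<comment> \<open>The distinguished point survives, so the second alternative
        persists.\<close>
      then have "p (path F (Suc n)) = p A"
        unfolding eq using ps by auto
      then show ?thesis
        unfolding leads_to_def using 2 A(2) True eq by auto
    next
      case False
      \<comment> \<open>Here \<open>p A\<close> is cut off, and \<open>F\<close> meets the half kept
        in \<open>y\<close> alone: the first alternative takes over.\<close>
      then show ?thesis
        unfolding leads_to_def eq using 2 A(2) by auto
    qed
  qed
qed

section \<open>The limit point of the path of a finite set\<close>

lemma leads_to_mem_path:
  assumes "leads_to F m y"
  shows "y \<in> path F n"
proof -
  have "leads_to F (m + k) y" for k
    by (induction k) (use assms leads_to_Suc in auto)
  \<comment> \<open>The index m + n is at least m, where the invariant starts, and at least n, where
    membership is wanted.\<close>
  then have "y \<in> path F (m + n)"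
    unfolding leads_to_def by blast
  then show ?thesis
    using path_antimono[of n "m + n" F] by auto
qed

text \<open>A half on which \<open>F\<close> is odd is nonempty. The half kept is of this kind
  unless \<open>F\<close> is even on both halves, and then it contains \<open>p A\<close>.\<close>

lemma path_nonempty:
  assumes "finite F"
  shows "path F n \<noteq> {}"
proof (induction n)
  case (Suc n)
  define A where "A = path F n"
  have A: "openin X A" "A \<noteq> {}"
    using Suc path_openin unfolding A_def by auto
  have pA: "p A \<in> A"
    using p_in A by blast
  have "card (F \<inter> A) = card (F \<inter> (A \<inter> C n)) + card (F \<inter> (A - C n))"
    using card_Int_Diff[of "F \<inter> A" "C n"] assms by (simp add: Int_assoc Int_Diff)
  then have "odd_on A F \<longleftrightarrow> odd_on (A \<inter> C n) F \<noteq> odd_on (A - C n) F"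
    unfolding odd_on_def by auto
  then show ?case
    using pA odd_on_imp_nonempty[of "A \<inter> C n" F] odd_on_imp_nonempty[of "A - C n" F]
    unfolding path.simps A_def[symmetric] by auto
qed (use nonempty in simp)

text \<open>At a stage that separates the points of \<open>F\<close> at most one of them is left.
  That point is the required \<open>y\<close>; if none is left, the distinguished point is.\<close>

lemma leads_to_exists:
  assumes "finite F" "F \<subseteq> topspace X"
  shows "\<exists>m y. leads_to F m y"
proof -
  obtain m where m: "\<And>x y. x \<in> F \<inter> path F m \<Longrightarrow> y \<in> F \<inter> path F m \<Longrightarrow> x = y"
    using path_separates[OF assms] by blast
  have "p (path F m) \<in> path F m"
    by (intro p_in path_openin path_nonempty assms(1))
  then have "leads_to F m (p (path F m))" if "F \<inter> path F m = {}"
    using that unfolding leads_to_def by simp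
  moreover have "leads_to F m y" if "y \<in> F \<inter> path F m" for y
    using that m unfolding leads_to_def by blast
  ultimately show ?thesis
    by blast
qed

text \<open>Both points lie in all stages, while some \<open>C k\<close> contains only one of them
  and stage k+1 lies on one side of it.\<close>

lemma leads_to_unique:
  assumes "leads_to F m y" "leads_to F n z"
  shows "y = z"
proof (rule ccontr)
  assume "y \<noteq> z"
  have y: "y \<in> path F k" and z: "z \<in> path F k" for k
    using assms leads_to_mem_path by blast+
  have "y \<in> topspace X" "z \<in> topspace X"
    using y[of 0] z[of 0] by auto
  then have "openin X (topspace X - {z})"
    using Hausdorff by (intro openin_diff closedin_Hausdorff_singleton) auto
  then obtain k where "y \<in> C k" "z \<notin> C k"
    using C_base[of "topspace X - {z}" y] \<open>y \<in> topspace X\<close> \<open>y \<noteq> z\<close> by blast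
  then show False
    using path_cut[of k "Suc k" F] y[of "Suc k"] z[of "Suc k"] by blast
qed

text \<open>\<open>X\<close> need not be compact, so decreasing nonempty clopen sets may have empty
  intersection. The limit is therefore taken from the invariant \<open>leads_to\<close>, which is
  reached because \<open>F\<close> is finite.\<close>

definition path_limit :: "'a set \<Rightarrow> 'a" where
  "path_limit F = (THE y. \<exists>m. leads_to F m y)"

lemma path_limit_eq: "leads_to F m y \<Longrightarrow> path_limit F = y"
  unfolding path_limit_def by (rule the_equality) (blast, metis leads_to_unique)

lemma leads_to_path_limit:
  assumes "finite F" "F \<subseteq> topspace X"
  obtains m where "leads_to F m (path_limit F)"
  using leads_to_exists[OF assms] path_limit_eq[of F] by auto

lemma path_limit_mem_path:
  "finite F \<Longrightarrow> F \<subseteq> topspace X \<Longrightarrow> path_limit F \<in> path F n"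
  by (erule (1) leads_to_path_limit) (rule leads_to_mem_path)

lemma path_limit_singleton:
  assumes "x \<in> topspace X"
  shows "path_limit {x} = x"
  \<comment> \<open>The first alternative of \<open>leads_to\<close> holds already at stage 0, which
    is the whole space.\<close>
  by (rule path_limit_eq[of _ 0]) (use assms in \<open>auto simp: leads_to_def\<close>)

section \<open>Continuity and openness of the limit map\<close>

lemma path_locally_constant:
  "\<exists>\<D>. finite \<D> \<and> \<D> \<subseteq> clopens X \<and> (\<forall>E\<in>parity_nbhd X \<D> F. path E n = path F n)"
proof (induction n)
  case 0
  show ?case
    by (intro exI[of _ "{}"]) simp
next
  case (Suc n)
  then obtain \<D> where D: "finite \<D>" "\<D> \<subseteq> clopens X"
    "\<And>E. E \<in> parity_nbhd X \<D> F \<Longrightarrow> path E n = path F n"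
    by blast
  \<comment> \<open>The step from n to n+1 consults the finite set only through its parities on
    these two clopen sets.\<close>
  let ?D = "{path F n, path F n \<inter> C n} \<union> \<D>"
  have "path E (Suc n) = path F (Suc n)" if E: "E \<in> parity_nbhd X ?D F" for E
  proof -
    have "E \<in> parity_nbhd X \<D> F" and "odd_on (path F n) E = odd_on (path F n) F"
      and "odd_on (path F n \<inter> C n) E = odd_on (path F n \<inter> C n) F"
      using E unfolding parity_nbhd_def by auto
    then show ?thesis
      using D(3)[of E] by (simp only: path.simps)
  qed
  moreover have "?D \<subseteq> clopens X"
    using D(2) path_clopen[of F n] C_clopen[of n] by (auto simp: clopens_def)
  ultimately show ?case
    using D(1) by (intro exI[of _ ?D]) auto
qed

lemma continuous_map_path_limit: "continuous_map (parity_topology X) X path_limit"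
  unfolding continuous_map_def
proof (intro conjI allI impI)
  let ?T = "parity_topology X"
  show "path_limit \<in> topspace ?T \<rightarrow> topspace X"
    using path_limit_mem_path[of _ 0] by auto
  fix W
  assume W: "openin X W"
  show "openin ?T {F \<in> topspace ?T. path_limit F \<in> W}"
  proof (subst openin_subopen, intro ballI)
    fix F
    assume "F \<in> {F \<in> topspace ?T. path_limit F \<in> W}"
    then have F: "finite F" "F \<subseteq> topspace X" "path_limit F \<in> W"
      by auto
    obtain n where n: "path_limit F \<in> C n" "C n \<subseteq> W"
      using C_base[OF W F(3)] by blast
    \<comment> \<open>Stage n+1 is the first one cut by \<open>C n\<close>; as it contains the
      limit, it lies inside \<open>C n\<close>. Every \<open>E\<close> that shares this stage has
      its limit in \<open>W\<close>.\<close>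
    have sub: "path F (Suc n) \<subseteq> W"
      using path_cut[of n "Suc n" F] path_limit_mem_path[OF F(1,2), of "Suc n"] n by blast
    obtain \<D> where D: "finite \<D>" "\<D> \<subseteq> clopens X"
      "\<And>E. E \<in> parity_nbhd X \<D> F \<Longrightarrow> path E (Suc n) = path F (Suc n)"
      using path_locally_constant by metis
    have "path_limit E \<in> W" if E: "E \<in> parity_nbhd X \<D> F" for E
      using path_limit_mem_path[of E "Suc n"] D(3)[OF E] E sub unfolding parity_nbhd_def by auto
    then have "parity_nbhd X \<D> F \<subseteq> {F \<in> topspace ?T. path_limit F \<in> W}"
      by (auto simp: parity_nbhd_def)
    then show "\<exists>U. openin ?T U \<and> F \<in> U \<and> U \<subseteq> {F \<in> topspace ?T. path_limit F \<in> W}"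
      using openin_parity_nbhd[OF D(1,2), of F] parity_nbhd_self[of F X \<D>] F by auto
  qed
qed

text \<open>The map \<open>g\<close> is a continuous section of \<open>path_limit\<close> over the
  neighbourhood \<open>A\<close> of \<open>a\<close>, with value \<open>F\<close> at
  \<open>a\<close>. The part of \<open>A\<close> that \<open>g\<close> sends into \<open>U\<close>
  is thus an open neighbourhood of \<open>a\<close> inside the image.\<close>

lemma open_map_path_limit: "open_map (parity_topology X) X path_limit"
  unfolding open_map_def
proof (intro allI impI)
  let ?T = "parity_topology X"
  fix U
  assume U: "openin ?T U"
  show "openin X (path_limit ` U)"
  proof (subst openin_subopen, intro ballI)
    fix a
    assume "a \<in> path_limit ` U"
    then obtain F where F: "F \<in> U" "a = path_limit F"
      by blast
    then have fin: "finite F" "F \<subseteq> topspace X"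
      using openin_subset[OF U] by (auto simp: subset_iff)
    obtain m where m: "leads_to F m a"
      using leads_to_path_limit[OF fin] F(2) by blast
    define A where "A = path F m"
    have aA: "a \<in> A"
      using m unfolding leads_to_def A_def by blast
    then have aX: "a \<in> topspace X"
      using openin_subset[OF path_openin, of F m] unfolding A_def by blast
    define g where "g y = sym_diff (sym_diff F {a}) {y}" for y
    have "continuous_map X ?T g"
      unfolding g_def using fin aX by (intro continuous_map_translated_singleton) auto
    then have "openin X ({y \<in> topspace X. g y \<in> U} \<inter> A)"
      using U path_openin unfolding A_def by (intro openin_Int openin_continuous_map_preimage) auto
    moreover have "g a = F"
      unfolding g_def by auto
    then have "a \<in> {y \<in> topspace X. g y \<in> U} \<inter> A"
      using F(1) aA aX by simp
    moreover have "path_limit (g y) = y" if y: "y \<in> A" for y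
    proof -
      \<comment> \<open>\<open>g y\<close> arises from \<open>F\<close> by adding {a} and {y}, whose
        parities on such a \<open>D\<close> cancel.\<close>
      have parity: "odd_on D (g y) = odd_on D F" if "a \<in> D \<longleftrightarrow> y \<in> D" for D
        using that fin(1) unfolding g_def
        by (simp only: odd_on_sym_diff finite.intros odd_on_singleton finite_Un finite_Diff) blast
      \<comment> \<open>Up to stage \<open>m\<close> both sets take the same steps: the points
        \<open>a\<close> and \<open>y\<close> of \<open>A\<close> have not been separated, so every
        parity consulted is the same.\<close>
      have "path (g y) n = path F n" if "n \<le> m" for n
        using that
      proof (induction n)
        case (Suc n)
        have "a \<in> path F k \<and> y \<in> path F k" if "k \<le> m" for k
          using path_antimono[OF that, of F] aA y unfolding A_def by blast
        then have "a \<in> path F n" "y \<in> path F n" "a \<in> path F (Suc n)" "y \<in> path F (Suc n)"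
          using Suc.prems Suc_leD by blast+
        moreover have "a \<in> C n \<longleftrightarrow> y \<in> C n"
          using path_cut[of n "Suc n" F] calculation by blast
        ultimately have "odd_on (path F n) (g y) = odd_on (path F n) F"
          "odd_on (path F n \<inter> C n) (g y) = odd_on (path F n \<inter> C n) F"
          by (intro parity; blast)+
        then show ?case
          using Suc by (simp only: path.simps Suc_leD)
      qed simp
      then have eq: "path (g y) m = A"
        unfolding A_def by simp
      \<comment> \<open>Inside \<open>A\<close> the change puts \<open>y\<close> in the place of
        \<open>a\<close> in either alternative of \<open>leads_to\<close>.\<close>
      have "g y \<inter> A = sym_diff (sym_diff (F \<inter> A) {a}) {y}"
        unfolding g_def using aA y by auto
      moreover have "F \<inter> A = {a} \<or> F \<inter> A = sym_diff {a} {p A}"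
        using m unfolding leads_to_def A_def by blast
      ultimately have "g y \<inter> A = {y} \<or> g y \<inter> A = sym_diff {y} {p A}"
        by auto
      then have "leads_to (g y) m y"
        unfolding leads_to_def eq using y by blast
      then show ?thesis
        by (rule path_limit_eq)
    qed
    then have "{y \<in> topspace X. g y \<in> U} \<inter> A \<subseteq> path_limit ` U"
      by (metis (mono_tags, lifting) IntE image_eqI mem_Collect_eq subsetI)
    ultimately show "\<exists>V. openin X V \<and> a \<in> V \<and> V \<subseteq> path_limit ` U"
      by blast
  qed
qed

end

text \<open>Take for \<open>p A\<close> the first term of a dense sequence that lies in
  \<open>A\<close>; if it lies in a subset \<open>B\<close>, it is also the first term in
  \<open>B\<close>.\<close>

lemma dense_sequence_choice:
  assumes "separable_space X" "topspace X \<noteq> {}"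
  shows "\<exists>p. (\<forall>A. openin X A \<and> A \<noteq> {} \<longrightarrow> p A \<in> A) \<and>
    (\<forall>A B. B \<subseteq> A \<and> p A \<in> B \<longrightarrow> p B = p A)"
proof -
  obtain S where S: "countable S" "S \<subseteq> topspace X" "X closure_of S = topspace X"
    using assms(1) unfolding separable_space_def by blast
  then have "S \<noteq> {}"
    using assms(2) by (metis closure_of_empty)
  define d where "d = from_nat_into S"
  have d: "range d = S"
    unfolding d_def using S(1) \<open>S \<noteq> {}\<close> by (rule range_from_nat_into[rotated])
  define p where "p A = d (LEAST k. d k \<in> A)" for A
  show ?thesis
  proof (intro exI[of _ p] conjI allI impI)
    fix A
    assume "openin X A \<and> A \<noteq> {}"
    then have A: "openin X A" "A \<noteq> {}"
      by simp_all
    then have "S \<inter> A \<noteq> {}"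
      using S(3) openin_Int_closure_of_eq_empty[of X A S] openin_subset[OF A(1)] by auto
    then obtain k where "d k \<in> A"
      using d by blast
    then show "p A \<in> A"
      unfolding p_def by (rule LeastI)
  next
    fix A B
    assume "B \<subseteq> A \<and> p A \<in> B"
    then have "(LEAST k. d k \<in> B) = (LEAST k. d k \<in> A)"
      unfolding p_def by (intro Least_equality) (auto intro: Least_le)
    then show "p B = p A"
      unfolding p_def by simp
  qed
qed

theorem corollary1:
  fixes X :: "'a topology"
  assumes "topspace X \<noteq> {}"
    and "separable_space X"
    and "metrizable_space X"
    and "zero_dimensional_space X"
  shows "\<exists>(G :: 'a set monoid) (T :: 'a set topology) (e :: 'a \<Rightarrow> 'a set) (r :: 'a set \<Rightarrow> 'a set).
           boolean_group G \<and> precompact_group G T \<and> Hausdorff_space T \<and>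
           embedding_map X T e \<and>
           retraction_maps T (subtopology T (e ` topspace X)) r id \<and>
           open_map T (subtopology T (e ` topspace X)) r"
proof -
  have Hausdorff: "Hausdorff_space X"
    using assms(3) by (rule metrizable_imp_Hausdorff_space)
  obtain C :: "nat \<Rightarrow> 'a set" where C: "\<forall>n. openin X (C n) \<and> closedin X (C n)"
    "\<forall>W x. openin X W \<and> x \<in> W \<longrightarrow> (\<exists>n. x \<in> C n \<and> C n \<subseteq> W)"
    using countable_clopen_base[OF separable_metrizable_imp_second_countable[OF assms(2,3)] assms(4)]
    by (elim exE conjE)
  obtain p where p: "\<forall>A. openin X A \<and> A \<noteq> {} \<longrightarrow> p A \<in> A"
    "\<forall>A B. B \<subseteq> A \<and> p A \<in> B \<longrightarrow> p B = p A"
    using dense_sequence_choice[OF assms(2,1)] by (elim exE conjE)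
  interpret pointed_clopen_splitting X C p
  proof
    show "C n \<in> clopens X" for n
      using C(1) by (simp add: clopens_def)
    show "\<exists>n. x \<in> C n \<and> C n \<subseteq> W" if "openin X W" "x \<in> W" for W x
      using C(2) that by blast
    show "p A \<in> A" if "openin X A" "A \<noteq> {}" for A
      using p(1) that by blast
    show "p B = p A" if "B \<subseteq> A" "p A \<in> B" for A B
      using p(2) that by blast
  qed (fact Hausdorff assms(1))+
  let ?T = "parity_topology X" and ?e = "\<lambda>x. {x} :: 'a set"
  let ?S = "subtopology ?T (?e ` topspace X)"
  have emb: "embedding_map X ?T ?e"
    by (rule embedding_map_singleton[OF assms(4)])
  then have hom: "homeomorphic_map X ?S ?e"
    unfolding embedding_map_def .
  \<comment> \<open>\<open>path_limit\<close> takes values in \<open>X\<close>; the homeomorphism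
    onto the set of singletons carries it to a self-map of the group, and its continuity and
    openness carry over.\<close>
  have "continuous_map ?T ?S (?e \<circ> path_limit)"
    using continuous_map_path_limit homeomorphic_imp_continuous_map[OF hom]
    by (rule continuous_map_compose)
  moreover have "continuous_map ?S ?T id"
    by (rule continuous_map_from_subtopology) simp
  moreover have "(?e \<circ> path_limit) (id F) = F" if "F \<in> topspace ?S" for F
    using that by (auto simp: path_limit_singleton)
  ultimately have retr: "retraction_maps ?T ?S (?e \<circ> path_limit) id"
    unfolding retraction_maps_def by blast
  have opn: "open_map ?T ?S (?e \<circ> path_limit)"
    using open_map_path_limit homeomorphic_imp_open_map[OF hom] by (rule open_map_compose)
  show ?thesis
    by (intro exI conjI) (rule boolean_group_finite_subset_group precompact_group_parity_topology
      Hausdorff_parity_topology[OF Hausdorff assms(4)] emb retr opn)+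
qed

end
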